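(* (Discrete Noether theorem.) Let $L:J^1Y\to\mathbb{R}$ be a smooth discrete Lagrangian and suppose that a Lie group $G$ with Lie algebra $\mathfrak{g}$ acts on $\mathsf{F}$ (hence by vertical symmetries on $Y$ and on $J^1Y$) in such a way that $L$ is $G$-invariant. Let $U\subseteq X=\mathbb{Z}\times\mathbb{Z}$ be finite and regular and let $\phi\in\mathcal{C}_U$ be a solution of the discrete Euler–Lagrange field equations on $U$. Then $$\sum_{\Delta\subseteq U;\ \Delta\cap\partial U\neq\emptyset}\ \left(\sum_{l;\ \Delta^l\in\partial U}J^l(\Delta)\right)=0 ,$$ where $J^l$, $l=1,2,3$, are the three $\mathfrak{g}^*$-valued momentum maps with components $J^l_\xi=\xi_{J^1Y}\lrcorner\,\Theta_L^l$, $\xi\in\mathfrak{g}$, and $J^l(\Delta)$ denotes the value of $J^l$ at $j^1\phi(\Delta)$.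
   Context: $X=\mathbb{Z}\times\mathbb{Z}$, $\mathsf{F}$ is a smooth manifold and $Y=X\times\mathsf{F}$. A triangle is an ordered triple $\Delta=((i,j),(i,j+1),(i+1,j+1))$ with first, second, third vertices $\Delta^1,\Delta^2,\Delta^3$; the same symbol denotes its set of vertices; $X^\Delta$ is the set of all triangles. A triangle touches a point if the point is one of its vertices. For $U\subseteq X$: $(i,j)\in U$ is an interior point if $U$ contains all three triangles touching $(i,j)$; $\operatorname{int}U$ is the set of interior points; $\operatorname{cl}U$ is the union of all triangles touching interior points of $U$; $\partial U=(U\cap\operatorname{cl}U)\setminus\operatorname{int}U$; $U$ is regular if $U=\operatorname{int}U\cup\partial U$. The discrete first jet bundle is $J^1Y=X^\Delta\times\mathsf{F}^3$. $\mathcal{C}_U$ is the manifold of sections $\phi:U\to Y$ (assignments $(i,j)\mapsto y_{ij}\in\mathsf{F}$); $j^1\phi(\Delta)=(\Delta,\phi(\Delta^1),\phi(\Delta^2),\phi(\Delta^3))$. Put $L_\Delta(y^1,y^2,y^3)=L(\Delta,y^1,y^2,y^3)$; the action is $S(\phi)=\sum_{\Delta\subseteq U}L(j^1\phi(\Delta))$. The discrete Euler–Lagrange field equations are: for all $(i,j)\in\operatorname{int}U$, $$\sum_{(\Delta,l):\,\Delta^l=(i,j)}\frac{\partial L_\Delta}{\partial y^l}(y_{\Delta^1},y_{\Delta^2},y_{\Delta^3})=0 .$$ For $l=1,2,3$, $\Theta_L^l$ is the one-form on $J^1Y$ given on $\{\Delta\}\times\mathsf{F}^3$ by $\Theta_L^l(y_{\Delta^1},y_{\Delta^2},y_{\Delta^3})\cdot(v_1,v_2,v_3)=\frac{\partial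 L_\Delta}{\partial y^l}(y_{\Delta^1},y_{\Delta^2},y_{\Delta^3})\cdot v_l$. $G$ acts on $J^1Y$ diagonally on $\mathsf{F}^3$, fixing $\Delta$, and $\xi_{J^1Y}$ is the infinitesimal generator of $\xi$; $\lrcorner$ denotes interior product. *)

theory Defs
  imports "HOL-Analysis.Analysis" "HOL-Algebra.Group_Action" "HOL-Library.Function_Algebras"
begin

section \<open>Smooth manifolds\<close>

text \<open>
  The model space \<open>'v\<close> of a manifold is a normed space that is required to be
  finite-dimensional in \<open>smooth_manifold\<close> below.  The class \<open>euclidean_space\<close> is not used,
  because it has no instance of dimension 0 and would exclude discrete manifolds and
  discrete groups.  On a finite-dimensional space, \<open>C\<^sup>k\<close> can be defined by iterating
  directional derivatives as in \<open>Ck_on\<close>; it is used for open \<open>S\<close> only.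
\<close>

primrec Ck_on ::
    "nat \<Rightarrow> 'a::real_normed_vector set \<Rightarrow> ('a \<Rightarrow> 'b::real_normed_vector) \<Rightarrow> bool" where
  "Ck_on 0 S f \<longleftrightarrow> continuous_on S f"
| "Ck_on (Suc k) S f \<longleftrightarrow>
     (\<forall>x\<in>S. f differentiable (at x)) \<and> (\<forall>v. Ck_on k S (\<lambda>x. frechet_derivative f (at x) v))"

definition smooth_on ::
    "'a::real_normed_vector set \<Rightarrow> ('a \<Rightarrow> 'b::real_normed_vector) \<Rightarrow> bool" where
  "smooth_on S f \<longleftrightarrow> (\<forall>k. Ck_on k S f)"

text \<open>A chart is a pair of its domain and its coordinate map.\<close>

type_synonym ('p, 'v) chart = "'p set \<times> ('p \<Rightarrow> 'v)"

record ('p, 'v) manifold =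
  mtop :: "'p topology"
  atlas :: "('p, 'v) chart set"

abbreviation points :: "('p, 'v) manifold \<Rightarrow> 'p set" where
  "points M \<equiv> topspace (mtop M)"

abbreviation chart_inv :: "('p, 'v) chart \<Rightarrow> 'v \<Rightarrow> 'p" where
  "chart_inv c \<equiv> inv_into (fst c) (snd c)"

definition charts_at :: "('p, 'v) manifold \<Rightarrow> 'p \<Rightarrow> ('p, 'v) chart set" where
  "charts_at M p = {c \<in> atlas M. p \<in> fst c}"

definition smooth_manifold :: "('p, 'v::real_normed_vector) manifold \<Rightarrow> bool" where
  "smooth_manifold M \<longleftrightarrow>
     (\<exists>B::'v set. finite B \<and> span B = UNIV) \<and>
     Hausdorff_space (mtop M) \<and> second_countable (mtop M) \<and>
     (\<Union>c\<in>atlas M. fst c) = points M \<and>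
     (\<forall>(D, c)\<in>atlas M. openin (mtop M) D \<and> open (c ` D) \<and>
        homeomorphic_map (subtopology (mtop M) D) (top_of_set (c ` D)) c) \<and>
     (\<forall>(D, c)\<in>atlas M. \<forall>(E, d)\<in>atlas M. smooth_on (c ` (D \<inter> E)) (d \<circ> inv_into D c))"

definition prod_manifold ::
    "('p, 'v) manifold \<Rightarrow> ('q, 'w) manifold \<Rightarrow> ('p \<times> 'q, 'v \<times> 'w) manifold" where
  "prod_manifold M N =
     \<lparr> mtop = prod_topology (mtop M) (mtop N),
       atlas = {(D \<times> E, map_prod c d) | D c E d. (D, c) \<in> atlas M \<and> (E, d) \<in> atlas N} \<rparr>"

text \<open>The product of a manifold with a discrete set: the disjoint union of copies of \<open>M\<close>
  indexed by \<open>I\<close>.\<close>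

definition discrete_prod_manifold ::
    "'i set \<Rightarrow> ('p, 'v) manifold \<Rightarrow> ('i \<times> 'p, 'v) manifold" where
  "discrete_prod_manifold I M =
     \<lparr> mtop = prod_topology (discrete_topology I) (mtop M),
       atlas = {({i} \<times> D, c \<circ> snd) | i D c. i \<in> I \<and> (D, c) \<in> atlas M} \<rparr>"

definition smooth_map ::
    "('p, 'v::real_normed_vector) manifold \<Rightarrow> ('q, 'w::real_normed_vector) manifold
      \<Rightarrow> ('p \<Rightarrow> 'q) \<Rightarrow> bool" where
  "smooth_map M N f \<longleftrightarrow>
     continuous_map (mtop M) (mtop N) f \<and>
     (\<forall>(D, c)\<in>atlas M. \<forall>(E, d)\<in>atlas N.
        smooth_on (c ` (D \<inter> f -` E)) (d \<circ> f \<circ> inv_into D c))"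

definition smooth_fun :: "('p, 'v::real_normed_vector) manifold \<Rightarrow> ('p \<Rightarrow> real) \<Rightarrow> bool" where
  "smooth_fun M f \<longleftrightarrow> (\<forall>(D, c)\<in>atlas M. smooth_on (c ` D) (f \<circ> inv_into D c))"

text \<open>
  A tangent vector at \<open>p\<close> assigns to every chart around \<open>p\<close> a coordinate vector, such that
  the coordinate vectors transform by the derivatives of the coordinate changes.  (The value
  at other charts is fixed to be 0.)
\<close>

type_synonym ('p, 'v) tangent = "('p, 'v) chart \<Rightarrow> 'v"

definition tangent_space ::
    "('p, 'v::real_normed_vector) manifold \<Rightarrow> 'p \<Rightarrow> ('p, 'v) tangent set" where
  "tangent_space M p =
     {v. (\<forall>c\<in>charts_at M p. \<forall>d\<in>charts_at M p.
            v d = frechet_derivative (snd d \<circ> chart_inv c) (at (snd c p)) (v c)) \<and>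
         (\<forall>c. c \<notin> charts_at M p \<longrightarrow> v c = 0)}"

text \<open>
  The derivative \<open>T\<^sub>p f : T\<^sub>p M \<rightarrow> T\<^bsub>f p\<^esub> N\<close> of a map, and the differential of a real function, are
  computed in an arbitrary chart around \<open>p\<close>; by the chain rule the choice does not matter.
\<close>

definition tangent_map ::
    "('p, 'v::real_normed_vector) manifold \<Rightarrow> ('q, 'w::real_normed_vector) manifold
      \<Rightarrow> ('p \<Rightarrow> 'q) \<Rightarrow> 'p \<Rightarrow> ('p, 'v) tangent \<Rightarrow> ('q, 'w) tangent" where
  "tangent_map M N f p v =
     (let c = (SOME c. c \<in> charts_at M p)
      in (\<lambda>d. if d \<in> charts_at N (f p)
              then frechet_derivative (snd d \<circ> f \<circ> chart_inv c) (at (snd c p)) (v c)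
              else 0))"

definition differential ::
    "('p, 'v::real_normed_vector) manifold \<Rightarrow> ('p \<Rightarrow> real) \<Rightarrow> 'p \<Rightarrow> ('p, 'v) tangent \<Rightarrow> real" where
  "differential M f p v =
     (let c = (SOME c. c \<in> charts_at M p)
      in frechet_derivative (f \<circ> chart_inv c) (at (snd c p)) (v c))"

text \<open>A vector field, or a one-form, is a function of the base point; vector fields take values
  in tangent vectors and one-forms in functionals on tangent vectors.\<close>

definition interior_product ::
    "('p \<Rightarrow> ('p, 'v) tangent) \<Rightarrow> ('p \<Rightarrow> ('p, 'v) tangent \<Rightarrow> real) \<Rightarrow> 'p \<Rightarrow> real"
    (infixr "\<lrcorner>" 75) where
  "(X \<lrcorner> \<alpha>) p = \<alpha> p (X p)"


section \<open>Lie groups and their actions\<close>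

definition lie_group :: "'g monoid \<Rightarrow> ('g, 'h::real_normed_vector) manifold \<Rightarrow> bool" where
  "lie_group G GM \<longleftrightarrow>
     group G \<and> smooth_manifold GM \<and> points GM = carrier G \<and>
     smooth_map (prod_manifold GM GM) GM (\<lambda>(g, h). g \<otimes>\<^bsub>G\<^esub> h) \<and>
     smooth_map GM GM (\<lambda>g. inv\<^bsub>G\<^esub> g)"

text \<open>The vector space underlying the Lie algebra; its bracket is not needed.\<close>

definition lie_algebra ::
    "'g monoid \<Rightarrow> ('g, 'h::real_normed_vector) manifold \<Rightarrow> ('g, 'h) tangent set" where
  "lie_algebra G GM = tangent_space GM \<one>\<^bsub>G\<^esub>"

definition lie_group_action ::
    "'g monoid \<Rightarrow> ('g, 'h::real_normed_vector) manifold
      \<Rightarrow> ('p, 'v::real_normed_vector) manifold \<Rightarrow> ('g \<Rightarrow> 'p \<Rightarrow> 'p) \<Rightarrow> bool" where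
  "lie_group_action G GM M \<rho> \<longleftrightarrow>
     group_action G (points M) \<rho> \<and> smooth_map (prod_manifold GM M) M (\<lambda>(g, p). \<rho> g p)"

text \<open>\<open>\<xi>\<^sub>M(p) = d/dt|\<^bsub>t=0\<^esub> exp(t\<xi>)\<cdot>p\<close> is the image of \<open>\<xi>\<close> under the derivative at the identity
  of the orbit map \<open>g \<mapsto> g\<cdot>p\<close>.\<close>

definition infinitesimal_generator ::
    "'g monoid \<Rightarrow> ('g, 'h::real_normed_vector) manifold
      \<Rightarrow> ('p, 'v::real_normed_vector) manifold \<Rightarrow> ('g \<Rightarrow> 'p \<Rightarrow> 'p)
      \<Rightarrow> ('g, 'h) tangent \<Rightarrow> 'p \<Rightarrow> ('p, 'v) tangent" where
  "infinitesimal_generator G GM M \<rho> \<xi> p = tangent_map GM M (\<lambda>g. \<rho> g p) \<one>\<^bsub>G\<^esub> \<xi>"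


section \<open>The triangulated lattice\<close>

type_synonym point = "int \<times> int"
type_synonym triangle = "point \<times> point \<times> point"

text \<open>Components of triples, and replacement of a component, are indexed by \<open>l \<in> {1, 2, 3}\<close>.\<close>

definition component :: "nat \<Rightarrow> 'a \<times> 'a \<times> 'a \<Rightarrow> 'a" where
  "component l = (\<lambda>(a, b, c). if l = 1 then a else if l = 2 then b else c)"

definition replace_component :: "nat \<Rightarrow> 'a \<Rightarrow> 'a \<times> 'a \<times> 'a \<Rightarrow> 'a \<times> 'a \<times> 'a" where
  "replace_component l x =
     (\<lambda>(a, b, c). if l = 1 then (x, b, c) else if l = 2 then (a, x, c) else (a, b, x))"

definition triangles :: "triangle set" where
  "triangles = {((i, j), (i, j + 1), (i + 1, j + 1)) | i j. True}"

abbreviation vertex :: "nat \<Rightarrow> triangle \<Rightarrow> point" where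
  "vertex l \<Delta> \<equiv> component l \<Delta>"

definition vertices :: "triangle \<Rightarrow> point set" where
  "vertices \<Delta> = {vertex 1 \<Delta>, vertex 2 \<Delta>, vertex 3 \<Delta>}"

definition lattice_interior :: "point set \<Rightarrow> point set" where
  "lattice_interior U = {x \<in> U. \<forall>\<Delta>\<in>triangles. x \<in> vertices \<Delta> \<longrightarrow> vertices \<Delta> \<subseteq> U}"

definition lattice_closure :: "point set \<Rightarrow> point set" where
  "lattice_closure U = \<Union>{vertices \<Delta> | \<Delta>. \<Delta> \<in> triangles \<and> vertices \<Delta> \<inter> lattice_interior U \<noteq> {}}"

definition lattice_boundary :: "point set \<Rightarrow> point set" where
  "lattice_boundary U = (U \<inter> lattice_closure U) - lattice_interior U"

definition regular :: "point set \<Rightarrow> bool" where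
  "regular U \<longleftrightarrow> U = lattice_interior U \<union> lattice_boundary U"


section \<open>Discrete first-order field theory\<close>

type_synonym 'f jet = "triangle \<times> 'f \<times> 'f \<times> 'f"

definition jet_bundle :: "('f, 'v) manifold \<Rightarrow> ('f jet, 'v \<times> 'v \<times> 'v) manifold" where
  "jet_bundle F = discrete_prod_manifold triangles (prod_manifold F (prod_manifold F F))"

text \<open>A section is represented by its fibre component \<open>(i, j) \<mapsto> y\<^bsub>ij\<^esub>\<close>.\<close>

definition sections :: "point set \<Rightarrow> ('f, 'v) manifold \<Rightarrow> (point \<Rightarrow> 'f) set" where
  "sections U F = U \<rightarrow>\<^sub>E points F"

definition jet_prolongation :: "(point \<Rightarrow> 'f) \<Rightarrow> triangle \<Rightarrow> 'f jet" where
  "jet_prolongation \<phi> \<Delta> = (\<Delta>, \<phi> (vertex 1 \<Delta>), \<phi> (vertex 2 \<Delta>), \<phi> (vertex 3 \<Delta>))"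

definition jet_action :: "('g \<Rightarrow> 'f \<Rightarrow> 'f) \<Rightarrow> 'g \<Rightarrow> 'f jet \<Rightarrow> 'f jet" where
  "jet_action \<rho> g = (\<lambda>(\<Delta>, a, b, c). (\<Delta>, \<rho> g a, \<rho> g b, \<rho> g c))"

definition invariant_lagrangian ::
    "'g monoid \<Rightarrow> ('f, 'v) manifold \<Rightarrow> ('g \<Rightarrow> 'f \<Rightarrow> 'f) \<Rightarrow> ('f jet \<Rightarrow> real) \<Rightarrow> bool" where
  "invariant_lagrangian G F \<rho> L \<longleftrightarrow>
     (\<forall>g\<in>carrier G. \<forall>z\<in>points (jet_bundle F). L (jet_action \<rho> g z) = L z)"

text \<open>The covector \<open>\<partial>L\<^sub>\<Delta>/\<partial>y\<^sup>l (y\<^sup>1, y\<^sup>2, y\<^sup>3)\<close> on the tangent space of \<open>F\<close> at \<open>y\<^sup>l\<close>.\<close>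

definition partial_lagrangian ::
    "('f, 'v::real_normed_vector) manifold \<Rightarrow> ('f jet \<Rightarrow> real) \<Rightarrow> nat \<Rightarrow> 'f jet
      \<Rightarrow> ('f, 'v) tangent \<Rightarrow> real" where
  "partial_lagrangian F L l =
     (\<lambda>(\<Delta>, y). differential F (\<lambda>q. L (\<Delta>, replace_component l q y)) (component l y))"

definition discrete_euler_lagrange ::
    "('f, 'v::real_normed_vector) manifold \<Rightarrow> ('f jet \<Rightarrow> real) \<Rightarrow> point set \<Rightarrow> (point \<Rightarrow> 'f)
      \<Rightarrow> bool" where
  "discrete_euler_lagrange F L U \<phi> \<longleftrightarrow>
     (\<forall>x\<in>lattice_interior U. \<forall>v\<in>tangent_space F (\<phi> x).
        (\<Sum>(\<Delta>, l)\<in>{(\<Delta>, l). \<Delta> \<in> triangles \<and> l \<in> {1, 2, 3} \<and> vertex l \<Delta> = x}.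
           partial_lagrangian F L l (jet_prolongation \<phi> \<Delta>) v) = 0)"

text \<open>
  The components \<open>v\<^sub>1, v\<^sub>2, v\<^sub>3\<close> of a vector tangent to the jet bundle are its images under the
  derivatives of the three projections to \<open>F\<close>.
\<close>

definition Theta ::
    "('f, 'v::real_normed_vector) manifold \<Rightarrow> ('f jet \<Rightarrow> real) \<Rightarrow> nat \<Rightarrow> 'f jet
      \<Rightarrow> ('f jet, 'v \<times> 'v \<times> 'v) tangent \<Rightarrow> real" where
  "Theta F L l z w =
     partial_lagrangian F L l z (tangent_map (jet_bundle F) F (\<lambda>(\<Delta>, y). component l y) z w)"

text \<open>The value of \<open>J\<^sup>l\<close> at \<open>z\<close> is a functional on the Lie algebra; outside the Lie algebra its
  value is fixed to be 0, so that it vanishes as a functional iff it is the zero function.\<close>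

definition momentum_map ::
    "'g monoid \<Rightarrow> ('g, 'h::real_normed_vector) manifold \<Rightarrow> ('f, 'v::real_normed_vector) manifold
      \<Rightarrow> ('g \<Rightarrow> 'f \<Rightarrow> 'f) \<Rightarrow> ('f jet \<Rightarrow> real) \<Rightarrow> nat \<Rightarrow> 'f jet \<Rightarrow> ('g, 'h) tangent \<Rightarrow> real" where
  "momentum_map G GM F \<rho> L l z =
     (\<lambda>\<xi>. if \<xi> \<in> lie_algebra G GM
          then (infinitesimal_generator G GM (jet_bundle F) (jet_action \<rho>) \<xi> \<lrcorner> Theta F L l) z
          else 0)"

end

theory Submission
  imports Defs
begin

text \<open>
  The proof combines an identity for each triangle with an identity for each interior vertex.
  Fix \<open>\<xi>\<close> in the Lie algebra and write \<open>\<xi>\<^sub>F\<close> for its infinitesimal generator on \<open>F\<close>.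

  Triangles: splitting the differential of \<open>L\<close> on the jet bundle into its partial differentials
  gives \<open>dL = \<Theta>\<^sup>1 + \<Theta>\<^sup>2 + \<Theta>\<^sup>3\<close> (\<open>differential_eq_sum_Theta\<close>).  Evaluated on the generator of
  the action on jets, the left side is the derivative of \<open>L\<close> along a group orbit and vanishes
  by invariance.  Hence \<open>J\<^sup>1(\<Delta>) + J\<^sup>2(\<Delta>) + J\<^sup>3(\<Delta>) = 0\<close> for every triangle
  (\<open>sum_Theta_generator_eq_0\<close>).

  Vertices: \<open>J\<^sup>l\<^sub>\<xi>(\<Delta>)\<close> is \<open>\<partial>L\<^sub>\<Delta>/\<partial>y\<^sup>l\<close> applied to \<open>\<xi>\<^sub>F(y)\<close>, where \<open>y\<close> is the field
  value at \<open>\<Delta>\<^sup>l\<close> (\<open>jet_generator_component\<close>).  This tangent vector depends on the vertex only,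
  not on the triangle or on \<open>l\<close>, so the field equation at an interior vertex, tested against it,
  says that the momenta of all triangles at that vertex add up to 0.

  Summing the first identity over the triangles in \<open>U\<close> and removing the interior vertices by the
  second leaves the boundary vertices (\<open>boundary_sum_eq_0\<close>).

  Tangent maps and differentials are defined through arbitrarily selected charts.  The analytic
  part therefore consists of the chain rule in charts (\<open>chain_rule_through_chart\<close>), for a
  pointwise notion of differentiability under which projections, pairings and orbit maps are
  easily seen to be differentiable, and of the splitting of a differential on a product
  (\<open>differential_prod\<close>).
\<close>

section \<open>Derivatives of functions that agree near a point\<close>

text \<open>
  \<open>frechet_derivative\<close> chooses some derivative, so it suffices that both functions have the same
  derivatives at \<open>x\<close>.
\<close>

lemma frechet_derivative_cong:
  assumes "\<forall>\<^sub>F u in nhds x. f u = g u"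
  shows "frechet_derivative f (at x) = frechet_derivative g (at x)"
proof -
  have "(f has_derivative D) (at x) \<longleftrightarrow> (g has_derivative D) (at x)" for D
  proof -
    have "f x = g x" and "\<forall>\<^sub>F u in at x. f u = g u"
      using assms by (auto simp: eventually_nhds eventually_at_filter)
    then show ?thesis
      by (auto intro: has_derivative_transform_eventually simp: eventually_mono eq_commute)
  qed
  then show ?thesis
    unfolding frechet_derivative_def by simp
qed

lemma differentiable_cong:
  assumes "\<forall>\<^sub>F u in nhds x. f u = g u" and "g differentiable at x"
  shows "f differentiable at x"
proof -
  have "g x = f x" and "\<forall>\<^sub>F u in at x. g u = f u"
    using assms(1) by (auto simp: eventually_nhds eventually_at_filter elim!: eventually_mono)
  then show ?thesis
    using assms(2) unfolding differentiable_def
    by (blast intro: has_derivative_transform_eventually)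
qed

lemma smooth_on_differentiable:
  assumes "smooth_on S f" and "x \<in> S"
  shows "f differentiable at x"
proof -
  have "Ck_on (Suc 0) S f"
    using assms(1) unfolding smooth_on_def by blast
  then show ?thesis
    using assms(2) by simp
qed

section \<open>Charts of manifolds and of products\<close>

text \<open>
  This is what calculus in charts uses of the charts: injectivity to cancel \<open>chart_inv c\<close> against
  \<open>snd c\<close>, and an open image to do so on a whole neighbourhood.  It passes to products without
  having to establish all of \<open>smooth_manifold\<close> for the jet bundle.
\<close>

definition open_charts :: "('p, 'v::real_normed_vector) manifold \<Rightarrow> bool" where
  "open_charts M \<longleftrightarrow> (\<forall>c\<in>atlas M. inj_on (snd c) (fst c) \<and> open (snd c ` fst c))"

lemma open_chartsD:
  assumes "open_charts M" and "c \<in> charts_at M p"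
  shows "inj_on (snd c) (fst c)" and "open (snd c ` fst c)" and "p \<in> fst c"
    and "chart_inv c (snd c p) = p" and "\<forall>\<^sub>F u in nhds (snd c p). u \<in> snd c ` fst c"
  using assms unfolding open_charts_def charts_at_def
  by (auto simp: inv_into_f_f intro!: eventually_nhds_in_open)

lemma smooth_manifold_chart:
  assumes "smooth_manifold M" and "c \<in> atlas M"
  shows "openin (mtop M) (fst c)" and "open (snd c ` fst c)"
    and "homeomorphic_map (subtopology (mtop M) (fst c)) (top_of_set (snd c ` fst c)) (snd c)"
  using assms unfolding smooth_manifold_def by (auto simp: case_prod_beta)

lemma smooth_manifold_coordinate_change:
  assumes "smooth_manifold M" and "c \<in> atlas M" and "d \<in> atlas M"
  shows "smooth_on (snd c ` (fst c \<inter> fst d)) (snd d \<circ> chart_inv c)"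
  using assms unfolding smooth_manifold_def by (auto simp: case_prod_beta)

lemma open_charts_smooth_manifold:
  assumes "smooth_manifold M"
  shows "open_charts M"
  unfolding open_charts_def
proof (intro ballI conjI)
  fix c
  assume c: "c \<in> atlas M"
  show "open (snd c ` fst c)"
    by (rule smooth_manifold_chart(2)[OF assms c])
  have "fst c \<subseteq> points M"
    using smooth_manifold_chart(1)[OF assms c] by (rule openin_subset)
  then show "inj_on (snd c) (fst c)"
    using homeomorphic_imp_injective_map[OF smooth_manifold_chart(3)[OF assms c]]
    by (simp add: Int_absorb1)
qed

lemma charts_at_nonempty:
  assumes "smooth_manifold M" and "p \<in> points M"
  shows "charts_at M p \<noteq> {}"
proof -
  have "p \<in> (\<Union>c\<in>atlas M. fst c)"
    using assms unfolding smooth_manifold_def by blast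
  then show ?thesis
    unfolding charts_at_def by blast
qed

lemma some_chart:
  assumes "charts_at M p \<noteq> {}"
  shows "(SOME c. c \<in> charts_at M p) \<in> charts_at M p"
  using assms by (simp add: some_in_eq)

lemma charts_at_prod:
  "C \<in> charts_at (prod_manifold M N) (p, q) \<longleftrightarrow>
    (\<exists>c\<in>charts_at M p. \<exists>e\<in>charts_at N q. C = (fst c \<times> fst e, map_prod (snd c) (snd e)))"
  unfolding charts_at_def prod_manifold_def by fastforce

lemma charts_at_discrete_prod:
  "C \<in> charts_at (discrete_prod_manifold I M) (i, p) \<longleftrightarrow>
    i \<in> I \<and> (\<exists>c\<in>charts_at M p. C = ({i} \<times> fst c, snd c \<circ> snd))"
  unfolding charts_at_def discrete_prod_manifold_def by fastforce

lemma charts_at_prod_nonempty: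
  assumes "charts_at M p \<noteq> {}" and "charts_at N q \<noteq> {}"
  shows "charts_at (prod_manifold M N) (p, q) \<noteq> {}"
proof -
  obtain c e where "c \<in> charts_at M p" and "e \<in> charts_at N q"
    using assms by blast
  then have "(fst c \<times> fst e, map_prod (snd c) (snd e)) \<in> charts_at (prod_manifold M N) (p, q)"
    unfolding charts_at_prod by blast
  then show ?thesis
    by (metis empty_iff)
qed

lemma charts_at_discrete_prod_nonempty:
  assumes "charts_at M p \<noteq> {}" and "i \<in> I"
  shows "charts_at (discrete_prod_manifold I M) (i, p) \<noteq> {}"
proof -
  obtain c where "c \<in> charts_at M p"
    using assms by blast
  then have "({i} \<times> fst c, snd c \<circ> snd) \<in> charts_at (discrete_prod_manifold I M) (i, p)"
    unfolding charts_at_discrete_prod using assms(2) by blast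
  then show ?thesis
    by (metis empty_iff)
qed

lemma open_charts_prod:
  assumes "open_charts M" and "open_charts N"
  shows "open_charts (prod_manifold M N)"
  using assms unfolding open_charts_def prod_manifold_def
  by (fastforce simp: map_prod_surj_on intro: map_prod_inj_on open_Times)

lemma image_discrete_chart: "(c \<circ> snd) ` ({i} \<times> D) = c ` D"
  by force

lemma open_charts_discrete_prod:
  assumes "open_charts M"
  shows "open_charts (discrete_prod_manifold I M)"
  unfolding open_charts_def
proof
  fix C
  assume "C \<in> atlas (discrete_prod_manifold I M)"
  then obtain i c where c: "c \<in> atlas M" and C: "C = ({i} \<times> fst c, snd c \<circ> snd)"
    unfolding discrete_prod_manifold_def by auto
  show "inj_on (snd C) (fst C) \<and> open (snd C ` fst C)"
    using assms c unfolding open_charts_def C fst_conv snd_conv image_discrete_chart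
    by (auto simp: inj_on_def)
qed

lemma inv_into_map_prod:
  assumes "inj_on c D" and "inj_on e E" and "u \<in> c ` D" and "v \<in> e ` E"
  shows "inv_into (D \<times> E) (map_prod c e) (u, v) = (inv_into D c u, inv_into E e v)"
proof (rule inv_into_f_eq)
  show "inj_on (map_prod c e) (D \<times> E)"
    using assms(1,2) by (rule map_prod_inj_on)
qed (use assms in \<open>auto simp: inv_into_into f_inv_into_f\<close>)

lemma inv_into_discrete:
  assumes "inj_on c D" and "u \<in> c ` D"
  shows "inv_into ({i} \<times> D) (c \<circ> snd) u = (i, inv_into D c u)"
proof (rule inv_into_f_eq)
  show "inj_on (c \<circ> snd) ({i} \<times> D)"
    using assms(1) by (auto simp: inj_on_def)
qed (use assms in \<open>auto simp: inv_into_into f_inv_into_f\<close>)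

section \<open>Differentiable maps and the chain rule\<close>

text \<open>
  The first condition of the conjunction is continuity as far as it is needed: outside the
  domain of the chart \<open>d\<close> the coordinates \<open>snd d\<close> are meaningless, and the chain rule needs
  that \<open>f\<close> avoids this region near \<open>p\<close>.
\<close>

definition differentiable_map_at ::
    "('p, 'v::real_normed_vector) manifold \<Rightarrow> ('q, 'w::real_normed_vector) manifold
      \<Rightarrow> ('p \<Rightarrow> 'q) \<Rightarrow> 'p \<Rightarrow> bool" where
  "differentiable_map_at M N f p \<longleftrightarrow>
     (\<forall>c\<in>charts_at M p. \<forall>d\<in>charts_at N (f p).
        (\<forall>\<^sub>F u in nhds (snd c p). f (chart_inv c u) \<in> fst d) \<and>
        (snd d \<circ> f \<circ> chart_inv c) differentiable at (snd c p))"

definition differentiable_fun_at ::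
    "('p, 'v::real_normed_vector) manifold \<Rightarrow> ('p \<Rightarrow> real) \<Rightarrow> 'p \<Rightarrow> bool" where
  "differentiable_fun_at M f p \<longleftrightarrow>
     (\<forall>c\<in>charts_at M p. (f \<circ> chart_inv c) differentiable at (snd c p))"

text \<open>
  A tangent map is computed in the chart \<open>c\<close> that its definition selects, from any function \<open>h\<close>
  that agrees with the coordinate expression near the base point.
\<close>

lemma tangent_map_eqI:
  assumes "c = (SOME c. c \<in> charts_at M p)" and "d \<in> charts_at N (f p)"
    and ev: "\<forall>\<^sub>F u in nhds (snd c p). (snd d \<circ> f \<circ> chart_inv c) u = h u"
    and h: "(h has_derivative D) (at (snd c p))"
  shows "tangent_map M N f p v d = D (v c)"
  using assms(2)
  unfolding tangent_map_def Let_def assms(1)[symmetric] frechet_derivative_cong[OF ev]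
    frechet_derivative_at[OF h, symmetric]
  by simp

text \<open>
  Going through the coordinates \<open>d\<close> of the intermediate manifold changes nothing, since
  \<open>chart_inv d \<circ> snd d\<close> is the identity on the domain of \<open>d\<close>, where \<open>f\<close> takes its values
  near \<open>p\<close>.  Taking for \<open>h\<close> a coordinate map after a map \<open>g\<close>, a real function, or a
  coordinate map alone gives the functoriality of tangent maps, the chain rule for
  differentials, and the transformation law of tangent vectors.
\<close>

lemma chain_rule_through_chart:
  fixes M :: "('p, 'v::real_normed_vector) manifold"
    and N :: "('q, 'w::real_normed_vector) manifold"
    and h :: "'q \<Rightarrow> 'a::real_normed_vector"
  assumes "open_charts M" and "open_charts N" and "differentiable_map_at M N f p"
    and c: "c \<in> charts_at M p" and d: "d \<in> charts_at N (f p)"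
    and h: "(h \<circ> chart_inv d) differentiable at (snd d (f p))"
  shows "frechet_derivative (h \<circ> chart_inv d) (at (snd d (f p)))
           (frechet_derivative (snd d \<circ> f \<circ> chart_inv c) (at (snd c p)) v) =
         frechet_derivative (h \<circ> f \<circ> chart_inv c) (at (snd c p)) v"
    and "(h \<circ> f \<circ> chart_inv c) differentiable at (snd c p)"
proof -
  let ?F = "snd d \<circ> f \<circ> chart_inv c" and ?x = "snd c p"
  have ev: "\<forall>\<^sub>F u in nhds ?x. f (chart_inv c u) \<in> fst d" and F: "?F differentiable at ?x"
    using assms(3) c d unfolding differentiable_map_at_def by blast+
  have eq: "\<forall>\<^sub>F u in nhds ?x. (h \<circ> f \<circ> chart_inv c) u = ((h \<circ> chart_inv d) \<circ> ?F) u"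
    using ev by eventually_elim (simp add: open_chartsD(1)[OF assms(2) d])
  have Fx: "?F ?x = snd d (f p)"
    by (simp add: open_chartsD(4)[OF assms(1) c])
  have comp: "((h \<circ> chart_inv d) \<circ> ?F has_derivative
      frechet_derivative (h \<circ> chart_inv d) (at (snd d (f p))) \<circ> frechet_derivative ?F (at ?x))
      (at ?x)"
    by (rule diff_chain_at) (use F h in \<open>simp_all only: Fx frechet_derivative_works\<close>)
  show "(h \<circ> f \<circ> chart_inv c) differentiable at ?x"
    using differentiable_cong[OF eq] comp differentiable_def by blast
  show "frechet_derivative (h \<circ> chart_inv d) (at (snd d (f p)))
           (frechet_derivative ?F (at ?x) v) =
         frechet_derivative (h \<circ> f \<circ> chart_inv c) (at ?x) v"
    unfolding frechet_derivative_cong[OF eq] frechet_derivative_at[OF comp, symmetric] by simp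
qed

lemma tangent_map_compose:
  assumes "open_charts M" and "open_charts N" and "charts_at M p \<noteq> {}" and "charts_at N (f p) \<noteq> {}"
    and "differentiable_map_at M N f p" and "differentiable_map_at N P g (f p)"
  shows "tangent_map N P g (f p) (tangent_map M N f p v) = tangent_map M P (g \<circ> f) p v"
proof
  fix e
  show "tangent_map N P g (f p) (tangent_map M N f p v) e = tangent_map M P (g \<circ> f) p v e"
  proof (cases "e \<in> charts_at P (g (f p))")
    case True
    define d where "d = (SOME d. d \<in> charts_at N (f p))"
    have d: "d \<in> charts_at N (f p)"
      unfolding d_def using assms(4) by (rule some_chart)
    have "(snd e \<circ> g \<circ> chart_inv d) differentiable at (snd d (f p))"
      using assms(6) d True unfolding differentiable_map_at_def by blast
    from chain_rule_through_chart(1)[OF assms(1,2,5) some_chart[OF assms(3)] d this]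
    show ?thesis
      using True d unfolding tangent_map_def Let_def d_def[symmetric] by (simp add: comp_def)
  qed (simp add: tangent_map_def Let_def)
qed

lemma differential_compose:
  assumes "open_charts M" and "open_charts N" and "charts_at M p \<noteq> {}" and "charts_at N (f p) \<noteq> {}"
    and "differentiable_map_at M N f p" and "differentiable_fun_at N g (f p)"
  shows "differential N g (f p) (tangent_map M N f p v) = differential M (g \<circ> f) p v"
proof -
  define d where "d = (SOME d. d \<in> charts_at N (f p))"
  have d: "d \<in> charts_at N (f p)"
    unfolding d_def using assms(4) by (rule some_chart)
  have "(g \<circ> chart_inv d) differentiable at (snd d (f p))"
    using assms(6) d unfolding differentiable_fun_at_def by blast
  from chain_rule_through_chart(1)[OF assms(1,2,5) some_chart[OF assms(3)] d this]
  show ?thesis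
    using d unfolding differential_def tangent_map_def Let_def d_def[symmetric] by simp
qed

lemma differentiable_fun_at_compose:
  assumes "open_charts M" and "open_charts N" and "charts_at N (f p) \<noteq> {}"
    and "differentiable_map_at M N f p" and "differentiable_fun_at N g (f p)"
  shows "differentiable_fun_at M (g \<circ> f) p"
  using chain_rule_through_chart(2)[OF assms(1,2,4)] assms(3,5)
  unfolding differentiable_fun_at_def by blast

section \<open>Maps into and out of products\<close>

lemma differentiable_map_at_const: "differentiable_map_at M N (\<lambda>_. q) p"
  unfolding differentiable_map_at_def by (auto simp: charts_at_def comp_def)

lemma differentiable_map_at_Pair:
  assumes "differentiable_map_at M N f p" and "differentiable_map_at M P g p"
  shows "differentiable_map_at M (prod_manifold N P) (\<lambda>x. (f x, g x)) p"
  unfolding differentiable_map_at_def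
proof (intro ballI conjI)
  fix c C
  assume c: "c \<in> charts_at M p" and "C \<in> charts_at (prod_manifold N P) (f p, g p)"
  then obtain d e where d: "d \<in> charts_at N (f p)" and e: "e \<in> charts_at P (g p)"
    and C: "C = (fst d \<times> fst e, map_prod (snd d) (snd e))"
    unfolding charts_at_prod by blast
  note f = assms(1)[unfolded differentiable_map_at_def, rule_format, OF c d]
    and g = assms(2)[unfolded differentiable_map_at_def, rule_format, OF c e]
  show "\<forall>\<^sub>F u in nhds (snd c p). (f (chart_inv c u), g (chart_inv c u)) \<in> fst C"
    using eventually_conj[OF f[THEN conjunct1] g[THEN conjunct1]] by (simp add: C)
  have "(\<lambda>u. ((snd d \<circ> f \<circ> chart_inv c) u, (snd e \<circ> g \<circ> chart_inv c) u))
      differentiable at (snd c p)"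
    using f g unfolding differentiable_def by (blast intro: has_derivative_Pair)
  then show "(snd C \<circ> (\<lambda>x. (f x, g x)) \<circ> chart_inv c) differentiable at (snd c p)"
    by (simp add: C comp_def)
qed

lemma differentiable_map_at_discrete_Pair:
  assumes "differentiable_map_at M N f p"
  shows "differentiable_map_at M (discrete_prod_manifold I N) (\<lambda>x. (i, f x)) p"
  unfolding differentiable_map_at_def
proof (intro ballI)
  fix c C
  assume c: "c \<in> charts_at M p" and "C \<in> charts_at (discrete_prod_manifold I N) (i, f p)"
  then obtain d where d: "d \<in> charts_at N (f p)" and C: "C = ({i} \<times> fst d, snd d \<circ> snd)"
    unfolding charts_at_discrete_prod by blast
  show "(\<forall>\<^sub>F u in nhds (snd c p). (i, f (chart_inv c u)) \<in> fst C) \<and>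
      (snd C \<circ> (\<lambda>x. (i, f x)) \<circ> chart_inv c) differentiable at (snd c p)"
    using assms[unfolded differentiable_map_at_def, rule_format, OF c d] by (simp add: C comp_def)
qed

lemma eventually_nhds_Pair:
  assumes "\<forall>\<^sub>F u in nhds x. P u" and "\<forall>\<^sub>F v in nhds y. Q v"
  shows "\<forall>\<^sub>F w in nhds (x, y). P (fst w) \<and> Q (snd w)"
  unfolding nhds_prod using assms by (rule eventually_prodI)

lemma eventually_chart_inv_prod:
  assumes "open_charts M" and "open_charts N" and c: "c \<in> charts_at M p" and e: "e \<in> charts_at N q"
  shows "\<forall>\<^sub>F w in nhds (snd c p, snd e q).
    inv_into (fst c \<times> fst e) (map_prod (snd c) (snd e)) w = (chart_inv c (fst w), chart_inv e (snd w)) \<and>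
    fst w \<in> snd c ` fst c \<and> snd w \<in> snd e ` fst e"
  using eventually_nhds_Pair[OF open_chartsD(5)[OF assms(1) c] open_chartsD(5)[OF assms(2) e]]
  by eventually_elim
    (metis inv_into_map_prod open_chartsD(1)[OF assms(1) c] open_chartsD(1)[OF assms(2) e] prod.collapse)

lemma differentiable_map_at_compose_fst:
  assumes "open_charts M" and "open_charts N" and "differentiable_map_at M P f p"
  shows "differentiable_map_at (prod_manifold M N) P (\<lambda>x. f (fst x)) (p, q)"
  unfolding differentiable_map_at_def
proof (intro ballI conjI)
  fix C d
  assume "C \<in> charts_at (prod_manifold M N) (p, q)" and "d \<in> charts_at P (f (fst (p, q)))"
  then obtain c e where c: "c \<in> charts_at M p" and e: "e \<in> charts_at N q"
    and C: "C = (fst c \<times> fst e, map_prod (snd c) (snd e))" and d: "d \<in> charts_at P (f p)"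
    unfolding charts_at_prod by auto
  note f = assms(3)[unfolded differentiable_map_at_def, rule_format, OF c d]
  note inv = eventually_chart_inv_prod[OF assms(1,2) c e]
  have ev: "\<forall>\<^sub>F w in nhds (snd c p, snd e q). f (chart_inv c (fst w)) \<in> fst d"
    using eventually_nhds_Pair[OF f[THEN conjunct1] eventually_True] by simp
  show "\<forall>\<^sub>F w in nhds (snd C (p, q)). f (fst (chart_inv C w)) \<in> fst d"
    using eventually_conj[OF inv ev] by (auto simp: C elim: eventually_mono)
  have "((snd d \<circ> f \<circ> chart_inv c) \<circ> fst) differentiable at (snd c p, snd e q)"
    by (rule differentiable_chain_at)
      (use f in \<open>auto intro: bounded_linear_imp_differentiable bounded_linear_fst\<close>)
  moreover have "\<forall>\<^sub>F w in nhds (snd c p, snd e q). (snd d \<circ> (\<lambda>x. f (fst x)) \<circ> chart_inv C) w =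
      ((snd d \<circ> f \<circ> chart_inv c) \<circ> fst) w"
    using inv by (auto simp: C elim: eventually_mono)
  moreover have "snd C (p, q) = (snd c p, snd e q)"
    by (simp add: C)
  ultimately show "(snd d \<circ> (\<lambda>x. f (fst x)) \<circ> chart_inv C) differentiable at (snd C (p, q))"
    by (simp only: differentiable_cong)
qed

lemma differentiable_map_at_compose_snd:
  assumes "open_charts M" and "open_charts N" and "differentiable_map_at N P f q"
  shows "differentiable_map_at (prod_manifold M N) P (\<lambda>x. f (snd x)) (p, q)"
  unfolding differentiable_map_at_def
proof (intro ballI conjI)
  fix C d
  assume "C \<in> charts_at (prod_manifold M N) (p, q)" and "d \<in> charts_at P (f (snd (p, q)))"
  then obtain c e where c: "c \<in> charts_at M p" and e: "e \<in> charts_at N q"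
    and C: "C = (fst c \<times> fst e, map_prod (snd c) (snd e))" and d: "d \<in> charts_at P (f q)"
    unfolding charts_at_prod by auto
  note f = assms(3)[unfolded differentiable_map_at_def, rule_format, OF e d]
  note inv = eventually_chart_inv_prod[OF assms(1,2) c e]
  have ev: "\<forall>\<^sub>F w in nhds (snd c p, snd e q). f (chart_inv e (snd w)) \<in> fst d"
    using eventually_nhds_Pair[OF eventually_True f[THEN conjunct1]] by simp
  show "\<forall>\<^sub>F w in nhds (snd C (p, q)). f (snd (chart_inv C w)) \<in> fst d"
    using eventually_conj[OF inv ev] by (auto simp: C elim: eventually_mono)
  have "((snd d \<circ> f \<circ> chart_inv e) \<circ> snd) differentiable at (snd c p, snd e q)"
    by (rule differentiable_chain_at)
      (use f in \<open>auto intro: bounded_linear_imp_differentiable bounded_linear_snd\<close>)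
  moreover have "\<forall>\<^sub>F w in nhds (snd c p, snd e q). (snd d \<circ> (\<lambda>x. f (snd x)) \<circ> chart_inv C) w =
      ((snd d \<circ> f \<circ> chart_inv e) \<circ> snd) w"
    using inv by (auto simp: C elim: eventually_mono)
  moreover have "snd C (p, q) = (snd c p, snd e q)"
    by (simp add: C)
  ultimately show "(snd d \<circ> (\<lambda>x. f (snd x)) \<circ> chart_inv C) differentiable at (snd C (p, q))"
    by (simp only: differentiable_cong)
qed

lemma differentiable_map_at_discrete_snd:
  assumes "open_charts M" and "differentiable_map_at M P f p"
  shows "differentiable_map_at (discrete_prod_manifold I M) P (\<lambda>x. f (snd x)) (i, p)"
  unfolding differentiable_map_at_def
proof (intro ballI conjI)
  fix C d
  assume "C \<in> charts_at (discrete_prod_manifold I M) (i, p)" and "d \<in> charts_at P (f (snd (i, p)))"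
  then obtain c where c: "c \<in> charts_at M p"
    and C: "C = ({i} \<times> fst c, snd c \<circ> snd)" and d: "d \<in> charts_at P (f p)"
    unfolding charts_at_discrete_prod by auto
  note f = assms(2)[unfolded differentiable_map_at_def, rule_format, OF c d]
  have inv: "\<forall>\<^sub>F w in nhds (snd c p). snd (chart_inv C w) = chart_inv c w"
    using open_chartsD(5)[OF assms(1) c]
    by eventually_elim (simp add: C inv_into_discrete open_chartsD(1)[OF assms(1) c])
  show "\<forall>\<^sub>F w in nhds (snd C (i, p)). f (snd (chart_inv C w)) \<in> fst d"
    using eventually_conj[OF inv f[THEN conjunct1]] by (auto simp: C elim: eventually_mono)
  have "\<forall>\<^sub>F w in nhds (snd c p). (snd d \<circ> (\<lambda>x. f (snd x)) \<circ> chart_inv C) w =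
      (snd d \<circ> f \<circ> chart_inv c) w"
    using inv by (auto elim: eventually_mono)
  moreover have "snd C (i, p) = snd c p"
    by (simp add: C)
  ultimately show "(snd d \<circ> (\<lambda>x. f (snd x)) \<circ> chart_inv C) differentiable at (snd C (i, p))"
    using f by (simp only: differentiable_cong)
qed

section \<open>From smooth to differentiable maps\<close>

text \<open>
  This is how continuity enters the calculus in charts: it keeps the images of points near \<open>p\<close>
  inside a given open set, for instance the domain of a chart around \<open>f p\<close>.
\<close>

lemma eventually_preimage_in_chart:
  assumes M: "smooth_manifold M" and c: "c \<in> charts_at M p"
    and f: "continuous_map (mtop M) T f" and W: "openin T W" and "f p \<in> W"
  shows "\<forall>\<^sub>F u in nhds (snd c p). chart_inv c u \<in> points M \<and> f (chart_inv c u) \<in> W"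
proof -
  have cM: "c \<in> atlas M" and p: "p \<in> fst c"
    using c unfolding charts_at_def by auto
  note ch = smooth_manifold_chart[OF M cM]
  note inj = open_chartsD(1)[OF open_charts_smooth_manifold[OF M] c]
  have sub: "fst c \<subseteq> points M"
    using ch(1) by (rule openin_subset)
  define V where "V = fst c \<inter> {x \<in> points M. f x \<in> W}"
  have "openin (mtop M) V"
    unfolding V_def using openin_continuous_map_preimage[OF f W] ch(1) by (rule openin_Int[rotated])
  then have "openin (subtopology (mtop M) (fst c)) V"
    unfolding openin_subtopology V_def by blast
  then have "openin (top_of_set (snd c ` fst c)) (snd c ` V)"
    using homeomorphic_imp_open_map[OF ch(3)] unfolding open_map_def by blast
  then have "open (snd c ` V)"
    using ch(2) openin_open_trans by blast
  moreover have "snd c p \<in> snd c ` V"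
    using p sub \<open>f p \<in> W\<close> unfolding V_def by blast
  ultimately have "\<forall>\<^sub>F u in nhds (snd c p). u \<in> snd c ` V"
    by (rule eventually_nhds_in_open)
  then show ?thesis
    by eventually_elim (use inj in \<open>auto simp: V_def\<close>)
qed

lemma differentiable_map_at_id:
  assumes M: "smooth_manifold M"
  shows "differentiable_map_at M M (\<lambda>x. x) p"
  unfolding differentiable_map_at_def
proof (intro ballI conjI)
  fix c d
  assume c: "c \<in> charts_at M p" and d: "d \<in> charts_at M p"
  then have cM: "c \<in> atlas M" and dM: "d \<in> atlas M" and p: "p \<in> fst c" "p \<in> fst d"
    unfolding charts_at_def by auto
  have "continuous_map (mtop M) (mtop M) (\<lambda>x. x)"
    by simp
  from eventually_preimage_in_chart[OF M c this smooth_manifold_chart(1)[OF M dM] p(2)]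
  show "\<forall>\<^sub>F u in nhds (snd c p). chart_inv c u \<in> fst d"
    by (auto elim: eventually_mono)
  show "(snd d \<circ> (\<lambda>x. x) \<circ> chart_inv c) differentiable at (snd c p)"
    using smooth_on_differentiable[OF smooth_manifold_coordinate_change[OF M cM dM]] p
    by (simp add: comp_def)
qed

text \<open>
  This is the way from smoothness of a Lie group action, a condition on a product chart, to
  differentiability of the orbit maps: the coordinate expression of the slice is that of \<open>f\<close>
  after the affine map \<open>u \<mapsto> (u, snd e q)\<close>.
\<close>

lemma differentiable_map_at_slice:
  assumes M: "smooth_manifold M" and N: "open_charts N" and P: "smooth_manifold P"
    and f: "smooth_map (prod_manifold M N) P f"
    and q: "q \<in> points N" "charts_at N q \<noteq> {}"
  shows "differentiable_map_at M P (\<lambda>x. f (x, q)) p"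
  unfolding differentiable_map_at_def
proof (intro ballI conjI)
  fix c d
  assume c: "c \<in> charts_at M p" and d: "d \<in> charts_at P (f (p, q))"
  then have cM: "c \<in> atlas M" and dP: "d \<in> atlas P" and p: "p \<in> fst c" and fp: "f (p, q) \<in> fst d"
    unfolding charts_at_def by auto
  obtain e where e: "e \<in> charts_at N q"
    using q(2) by blast
  then have eN: "e \<in> atlas N" and qe: "q \<in> fst e"
    unfolding charts_at_def by auto
  have "continuous_map (prod_topology (mtop M) (mtop N)) (mtop P) f"
    using f unfolding smooth_map_def prod_manifold_def by simp
  moreover have "continuous_map (mtop M) (prod_topology (mtop M) (mtop N)) (\<lambda>x. (x, q))"
    using q(1) by (simp add: continuous_map_paired)
  ultimately have "continuous_map (mtop M) (mtop P) (f \<circ> (\<lambda>x. (x, q)))"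
    by (rule continuous_map_compose[rotated])
  then have cont: "continuous_map (mtop M) (mtop P) (\<lambda>x. f (x, q))"
    by (simp only: comp_def)
  from eventually_preimage_in_chart[OF M c cont smooth_manifold_chart(1)[OF P dP] fp]
  show "\<forall>\<^sub>F u in nhds (snd c p). f (chart_inv c u, q) \<in> fst d"
    by (auto elim: eventually_mono)
  define C where "C = (fst c \<times> fst e, map_prod (snd c) (snd e))"
  have "C \<in> atlas (prod_manifold M N)"
    using cM eN unfolding C_def prod_manifold_def by (cases c; cases e) auto
  then have "smooth_on (snd C ` (fst C \<inter> f -` fst d)) (snd d \<circ> f \<circ> chart_inv C)"
    using f dP unfolding smooth_map_def by (auto simp: case_prod_beta)
  then have D: "(snd d \<circ> f \<circ> chart_inv C) differentiable at (snd c p, snd e q)"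
    by (rule smooth_on_differentiable) (use p qe fp in \<open>force simp: C_def\<close>)
  have "((snd d \<circ> f \<circ> chart_inv C) \<circ> (\<lambda>u. (u, snd e q))) differentiable at (snd c p)"
  proof (rule differentiable_chain_at)
    show "(\<lambda>u. (u, snd e q)) differentiable at (snd c p)"
      using has_derivative_Pair[OF has_derivative_ident has_derivative_const]
      unfolding differentiable_def by blast
  qed (rule D)
  moreover have "\<forall>\<^sub>F u in nhds (snd c p). (snd d \<circ> (\<lambda>x. f (x, q)) \<circ> chart_inv c) u =
      ((snd d \<circ> f \<circ> chart_inv C) \<circ> (\<lambda>u. (u, snd e q))) u"
    using open_chartsD(5)[OF open_charts_smooth_manifold[OF M] c]
  proof eventually_elim
    case (elim u)
    have "chart_inv C (u, snd e q) = (chart_inv c u, q)"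
      unfolding C_def fst_conv snd_conv
      using inv_into_map_prod[OF open_chartsD(1)[OF open_charts_smooth_manifold[OF M] c]
          open_chartsD(1)[OF N e] elim imageI[OF qe]] open_chartsD(4)[OF N e] by simp
    then show ?case
      by simp
  qed
  ultimately show "(snd d \<circ> (\<lambda>x. f (x, q)) \<circ> chart_inv c) differentiable at (snd c p)"
    by (rule differentiable_cong[rotated])
qed

section \<open>Partial differentials on products\<close>

lemma frechet_derivative_add:
  assumes "f differentiable (at x)"
  shows "frechet_derivative f (at x) (v + w) = frechet_derivative f (at x) v + frechet_derivative f (at x) w"
  by (rule linear_add[OF linear_frechet_derivative[OF assms]])

text \<open>
  Let \<open>\<iota>\<^sub>1 x = (x, q)\<close> and \<open>\<iota>\<^sub>2 y = (p, y)\<close>.  By the chain rule the two summands are the values of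
  the differential of \<open>f\<close> at the images of \<open>w\<close> under the tangent maps of \<open>\<iota>\<^sub>1 \<circ> fst\<close> and
  \<open>\<iota>\<^sub>2 \<circ> snd\<close>.  In a product chart these images have the coordinates \<open>(w\<^sub>1, 0)\<close> and
  \<open>(0, w\<^sub>2)\<close>, which add up to those of \<open>w\<close>.
\<close>

lemma differential_prod:
  fixes M :: "('p, 'v::real_normed_vector) manifold" and N :: "('q, 'w::real_normed_vector) manifold"
  assumes M: "open_charts M" "differentiable_map_at M M (\<lambda>x. x) p"
    and N: "open_charts N" "differentiable_map_at N N (\<lambda>x. x) q"
    and ne: "charts_at M p \<noteq> {}" "charts_at N q \<noteq> {}"
    and f: "differentiable_fun_at (prod_manifold M N) f (p, q)"
  shows "differential (prod_manifold M N) f (p, q) w =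
    differential M (\<lambda>x. f (x, q)) p (tangent_map (prod_manifold M N) M fst (p, q) w) +
    differential N (\<lambda>y. f (p, y)) q (tangent_map (prod_manifold M N) N snd (p, q) w)"
proof -
  let ?P = "prod_manifold M N"
  note P = open_charts_prod[OF M(1) N(1)]
  have neP: "charts_at ?P (p, q) \<noteq> {}"
    using ne by (rule charts_at_prod_nonempty)
  define C where "C = (SOME C. C \<in> charts_at ?P (p, q))"
  have C': "C \<in> charts_at ?P (p, q)"
    unfolding C_def using neP by (rule some_chart)
  then obtain c e where c: "c \<in> charts_at M p" and e: "e \<in> charts_at N q"
    and C: "C = (fst c \<times> fst e, map_prod (snd c) (snd e))"
    unfolding charts_at_prod by blast
  have fd: "(f \<circ> chart_inv C) differentiable at (snd C (p, q))"
    using f C' unfolding differentiable_fun_at_def by blast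
  have dfst: "differentiable_map_at ?P M fst (p, q)" and dsnd: "differentiable_map_at ?P N snd (p, q)"
    by (rule differentiable_map_at_compose_fst[OF M(1) N(1) M(2)],
        rule differentiable_map_at_compose_snd[OF M(1) N])
  have dl: "differentiable_map_at M ?P (\<lambda>x. (x, q)) p" and dr: "differentiable_map_at N ?P (\<lambda>y. (p, y)) q"
    by (rule differentiable_map_at_Pair[OF M(2) differentiable_map_at_const],
        rule differentiable_map_at_Pair[OF differentiable_map_at_const N(2)])
  let ?l = "tangent_map ?P ?P ((\<lambda>x. (x, q)) \<circ> fst) (p, q) w"
    and ?r = "tangent_map ?P ?P ((\<lambda>y. (p, y)) \<circ> snd) (p, q) w"
  \<comment> \<open>Move both partial differentials to the product manifold, where they can be added.\<close>
  have 1: "differential M (\<lambda>x. f (x, q)) p (tangent_map ?P M fst (p, q) w) = differential ?P f (p, q) ?l"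
    using differential_compose[OF M(1) P ne(1) _ dl, of f "tangent_map ?P M fst (p, q) w"] neP f
      tangent_map_compose[OF P M(1) neP _ dfst, of ?P "\<lambda>x. (x, q)" w] ne(1) dl
    by (simp add: comp_def)
  have 2: "differential N (\<lambda>y. f (p, y)) q (tangent_map ?P N snd (p, q) w) = differential ?P f (p, q) ?r"
    using differential_compose[OF N(1) P ne(2) _ dr, of f "tangent_map ?P N snd (p, q) w"] neP f
      tangent_map_compose[OF P N(1) neP _ dsnd, of ?P "\<lambda>y. (p, y)" w] ne(2) dr
    by (simp add: comp_def)
  note inv = eventually_chart_inv_prod[OF M(1) N(1) c e]
  have evl: "\<forall>\<^sub>F u in nhds (snd C (p, q)). (snd C \<circ> ((\<lambda>x. (x, q)) \<circ> fst) \<circ> chart_inv C) u = (fst u, snd e q)"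
    using inv by (auto simp: C f_inv_into_f elim!: eventually_mono)
  have evr: "\<forall>\<^sub>F u in nhds (snd C (p, q)). (snd C \<circ> ((\<lambda>y. (p, y)) \<circ> snd) \<circ> chart_inv C) u = (snd c p, snd u)"
    using inv by (auto simp: C f_inv_into_f elim!: eventually_mono)
  have "((\<lambda>u. (fst u, snd e q)) has_derivative (\<lambda>u. (fst u, 0))) (at (snd C (p, q)))"
    by (auto intro!: derivative_eq_intros)
  from C' tangent_map_eqI[where f = "(\<lambda>x. (x, q)) \<circ> fst" and N = ?P and d = C,
      OF C_def _ evl this]
  have l: "?l C = (fst (w C), 0)"
    by simp
  have "((\<lambda>u. (snd c p, snd u)) has_derivative (\<lambda>u. (0, snd u))) (at (snd C (p, q)))"
    by (auto intro!: derivative_eq_intros)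
  from C' tangent_map_eqI[where f = "(\<lambda>y. (p, y)) \<circ> snd" and N = ?P and d = C,
      OF C_def _ evr this]
  have r: "?r C = (0, snd (w C))"
    by simp
  have sum: "w C = ?l C + ?r C"
    unfolding l r by (simp only: add_Pair add_0_left add_0_right prod.collapse)
  have "differential ?P f (p, q) w = differential ?P f (p, q) ?l + differential ?P f (p, q) ?r"
    unfolding differential_def Let_def C_def[symmetric]
    by (subst sum) (rule frechet_derivative_add[OF fd])
  then show ?thesis
    by (simp only: 1 2)
qed

text \<open>
  The same argument with a single summand, because the discrete factor carries no tangent
  directions: \<open>x \<mapsto> (i, snd x)\<close> has the identity as coordinate expression near \<open>(i, p)\<close>.
\<close>

lemma differential_discrete_prod:
  fixes M :: "('p, 'v::real_normed_vector) manifold"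
  assumes M: "open_charts M" "differentiable_map_at M M (\<lambda>x. x) p" and ne: "charts_at M p \<noteq> {}"
    and i: "i \<in> I" and f: "differentiable_fun_at (discrete_prod_manifold I M) f (i, p)"
  shows "differential (discrete_prod_manifold I M) f (i, p) w =
    differential M (\<lambda>x. f (i, x)) p (tangent_map (discrete_prod_manifold I M) M snd (i, p) w)"
proof -
  let ?P = "discrete_prod_manifold I M"
  note P = open_charts_discrete_prod[OF M(1), of I]
  have neP: "charts_at ?P (i, p) \<noteq> {}"
    using ne i by (rule charts_at_discrete_prod_nonempty)
  define C where "C = (SOME C. C \<in> charts_at ?P (i, p))"
  have C': "C \<in> charts_at ?P (i, p)"
    unfolding C_def using neP by (rule some_chart)
  then obtain c where c: "c \<in> charts_at M p" and C: "C = ({i} \<times> fst c, snd c \<circ> snd)"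
    unfolding charts_at_discrete_prod by blast
  have dsnd: "differentiable_map_at ?P M snd (i, p)"
    by (rule differentiable_map_at_discrete_snd[OF M])
  have dr: "differentiable_map_at M ?P (\<lambda>x. (i, x)) p"
    by (rule differentiable_map_at_discrete_Pair[OF M(2)])
  let ?r = "tangent_map ?P ?P ((\<lambda>x. (i, x)) \<circ> snd) (i, p) w"
  have 1: "differential M (\<lambda>x. f (i, x)) p (tangent_map ?P M snd (i, p) w) = differential ?P f (i, p) ?r"
    using differential_compose[OF M(1) P ne _ dr, of f "tangent_map ?P M snd (i, p) w"] neP f
      tangent_map_compose[OF P M(1) neP _ dsnd, of ?P "\<lambda>x. (i, x)" w] ne dr
    by (simp add: comp_def)
  have ev: "\<forall>\<^sub>F u in nhds (snd C (i, p)). (snd C \<circ> ((\<lambda>x. (i, x)) \<circ> snd) \<circ> chart_inv C) u = u"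
    using open_chartsD(5)[OF P C']
    by eventually_elim (auto simp: C f_inv_into_f inv_into_discrete open_chartsD(1)[OF M(1) c])
  from C' tangent_map_eqI[where f = "(\<lambda>x. (i, x)) \<circ> snd" and N = ?P and d = C,
      OF C_def _ ev has_derivative_ident]
  have "?r C = w C"
    by simp
  then show ?thesis
    unfolding 1 unfolding differential_def Let_def C_def[symmetric] by simp
qed

lemma differentiable_map_at_id_prod:
  assumes "open_charts M" and "open_charts N"
    and "differentiable_map_at M M (\<lambda>x. x) p" and "differentiable_map_at N N (\<lambda>x. x) q"
  shows "differentiable_map_at (prod_manifold M N) (prod_manifold M N) (\<lambda>x. x) (p, q)"
  using differentiable_map_at_Pair[OF differentiable_map_at_compose_fst[OF assms(1-3)]
      differentiable_map_at_compose_snd[OF assms(1,2,4)]] by simp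

lemma smooth_fun_differentiable_fun_at:
  assumes "smooth_fun M f"
  shows "differentiable_fun_at M f p"
  unfolding differentiable_fun_at_def
proof
  fix c
  assume "c \<in> charts_at M p"
  then have "smooth_on (snd c ` fst c) (f \<circ> chart_inv c)" and "snd c p \<in> snd c ` fst c"
    using assms unfolding smooth_fun_def charts_at_def by (auto simp: case_prod_beta)
  then show "(f \<circ> chart_inv c) differentiable at (snd c p)"
    by (rule smooth_on_differentiable)
qed

text \<open>
  Needed because the field equations are tested against tangent vectors only, and the proof
  of the conservation law tests them against infinitesimal generators.
\<close>

lemma tangent_map_in_tangent_space:
  assumes M: "open_charts M" and N: "smooth_manifold N" and ne: "charts_at M p \<noteq> {}"
    and f: "differentiable_map_at M N f p"
  shows "tangent_map M N f p v \<in> tangent_space N (f p)"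
proof -
  define k where "k = (SOME c. c \<in> charts_at M p)"
  have k: "k \<in> charts_at M p"
    unfolding k_def using ne by (rule some_chart)
  have chain: "frechet_derivative (snd d \<circ> f \<circ> chart_inv k) (at (snd k p)) (v k) =
      frechet_derivative (snd d \<circ> chart_inv c) (at (snd c (f p)))
        (frechet_derivative (snd c \<circ> f \<circ> chart_inv k) (at (snd k p)) (v k))"
    if c: "c \<in> charts_at N (f p)" and d: "d \<in> charts_at N (f p)" for c d
  proof (rule chain_rule_through_chart(1)[OF M open_charts_smooth_manifold[OF N] f k c, symmetric])
    show "(snd d \<circ> chart_inv c) differentiable at (snd c (f p))"
      using differentiable_map_at_id[OF N, of "f p"] c d unfolding differentiable_map_at_def
      by (simp add: comp_def)
  qed
  show ?thesis
    unfolding tangent_space_def tangent_map_def Let_def k_def[symmetric]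
  proof (intro CollectI conjI ballI allI impI, goal_cases)
    case (1 c d)
    show ?case
      unfolding if_P[OF 1(1)] if_P[OF 1(2)] by (rule chain[OF 1])
  qed simp
qed

section \<open>The differential of the Lagrangian\<close>

lemma points_jet_bundle:
  "(\<Delta>, a, b, c) \<in> points (jet_bundle F) \<longleftrightarrow>
    \<Delta> \<in> triangles \<and> a \<in> points F \<and> b \<in> points F \<and> c \<in> points F"
  unfolding jet_bundle_def discrete_prod_manifold_def prod_manifold_def by auto

lemma open_charts_jet:
  assumes "smooth_manifold F"
  shows "open_charts (jet_bundle F)"
  unfolding jet_bundle_def
  by (intro open_charts_prod open_charts_discrete_prod open_charts_smooth_manifold assms)

lemma charts_at_jet_nonempty:
  assumes F: "smooth_manifold F" and z: "z \<in> points (jet_bundle F)"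
  shows "charts_at (jet_bundle F) z \<noteq> {}"
proof -
  obtain \<Delta> a b c where abc: "z = (\<Delta>, a, b, c)"
    by (cases z)
  then have "\<Delta> \<in> triangles" "a \<in> points F" "b \<in> points F" "c \<in> points F"
    using z by (auto simp: points_jet_bundle)
  then show ?thesis
    unfolding abc jet_bundle_def
    by (intro charts_at_prod_nonempty charts_at_discrete_prod_nonempty charts_at_nonempty[OF F])
qed

lemma jet_component_eq:
  "(\<lambda>(\<Delta>, y). component 1 y) = fst \<circ> snd"
  "(\<lambda>(\<Delta>, y). component 2 y) = fst \<circ> (snd \<circ> snd)"
  "(\<lambda>(\<Delta>, y). component 3 y) = snd \<circ> (snd \<circ> snd)"
  by (auto simp: component_def fun_eq_iff)

lemma differentiable_jet_component:
  fixes F :: "('f, 'v::real_normed_vector) manifold"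
  assumes F: "smooth_manifold F" and l: "l \<in> {1, 2, 3}"
  shows "differentiable_map_at (jet_bundle F) F (\<lambda>(\<Delta>, y). component l y) z"
proof -
  note F' = open_charts_smooth_manifold[OF F]
  note F2 = open_charts_prod[OF F' F']
  note F3 = open_charts_prod[OF F' F2]
  note id = differentiable_map_at_id[OF F]
  obtain \<Delta> a b c where z: "z = (\<Delta>, a, b, c)"
    by (cases z)
  consider "l = 1" | "l = 2" | "l = 3"
    using l by auto
  then show ?thesis
  proof cases
    case 1
    then have eq: "(\<lambda>(\<Delta>, y). component l y) = (\<lambda>x :: 'f jet. fst (snd x))"
      by (auto simp: component_def)
    show ?thesis
      unfolding eq z jet_bundle_def
      by (rule differentiable_map_at_discrete_snd[OF F3 differentiable_map_at_compose_fst[OF F' F2 id]])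
  next
    case 2
    then have eq: "(\<lambda>(\<Delta>, y). component l y) = (\<lambda>x :: 'f jet. fst (snd (snd x)))"
      by (auto simp: component_def)
    show ?thesis
      unfolding eq z jet_bundle_def
      by (rule differentiable_map_at_discrete_snd[OF F3 differentiable_map_at_compose_snd[OF F' F2
            differentiable_map_at_compose_fst[OF F' F' id]]])
  next
    case 3
    then have eq: "(\<lambda>(\<Delta>, y). component l y) = (\<lambda>x :: 'f jet. snd (snd (snd x)))"
      by (auto simp: component_def)
    show ?thesis
      unfolding eq z jet_bundle_def
      by (rule differentiable_map_at_discrete_snd[OF F3 differentiable_map_at_compose_snd[OF F' F2
            differentiable_map_at_compose_snd[OF F' F' id]]])
  qed
qed

text \<open>
  \<open>dL = \<Theta>\<^sup>1 + \<Theta>\<^sup>2 + \<Theta>\<^sup>3\<close>.  The jet bundle is a nested product, so splitting the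
  differential factor by factor leaves the three partial differentials of \<open>L\<close>, applied to the
  images of \<open>w\<close> under compositions of projections; these compositions are the three
  projections to \<open>F\<close> that occur in \<open>\<Theta>\<^sup>l\<close>.
\<close>

lemma differential_eq_sum_Theta:
  assumes F: "smooth_manifold F" and z: "z \<in> points (jet_bundle F)"
    and L: "differentiable_fun_at (jet_bundle F) L z"
  shows "differential (jet_bundle F) L z w = (\<Sum>l\<in>{1, 2, 3}. Theta F L l z w)"
proof -
  let ?P2 = "prod_manifold F F" and ?J = "jet_bundle F"
  let ?P3 = "prod_manifold F ?P2"
  obtain \<Delta> a b c where abc: "z = (\<Delta>, a, b, c)"
    by (cases z)
  have D: "\<Delta> \<in> triangles" and y: "a \<in> points F" "b \<in> points F" "c \<in> points F"
    using z unfolding abc points_jet_bundle by auto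
  note F1 = open_charts_smooth_manifold[OF F]
  note F2 = open_charts_prod[OF F1 F1]
  note F3 = open_charts_prod[OF F1 F2]
  note J1 = open_charts_jet[OF F]
  note ne = charts_at_nonempty[OF F]
  note ne2 = charts_at_prod_nonempty[OF ne[OF y(2)] ne[OF y(3)]]
  note ne3 = charts_at_prod_nonempty[OF ne[OF y(1)] ne2]
  note neJ = charts_at_jet_nonempty[OF F z, unfolded abc]
  note id = differentiable_map_at_id[OF F]
  note id2 = differentiable_map_at_id_prod[OF F1 F1 id id]
  note id3 = differentiable_map_at_id_prod[OF F1 F2 id id2]
  have J: "?J = discrete_prod_manifold triangles ?P3"
    by (simp add: jet_bundle_def)
  have snd3: "differentiable_map_at ?J ?P3 snd (\<Delta>, a, b, c)"
    unfolding J by (rule differentiable_map_at_discrete_snd[OF F3 id3])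
  have fst1: "differentiable_map_at ?P3 F fst (a, b, c)" and snd2: "differentiable_map_at ?P3 ?P2 snd (a, b, c)"
    and fst2: "differentiable_map_at ?P2 F fst (b, c)" and snd1: "differentiable_map_at ?P2 F snd (b, c)"
    by (rule differentiable_map_at_compose_fst[OF F1 F2 id],
        rule differentiable_map_at_compose_snd[OF F1 F2 id2],
        rule differentiable_map_at_compose_fst[OF F1 F1 id],
        rule differentiable_map_at_compose_snd[OF F1 F1 id])
  have snd32: "differentiable_map_at ?J ?P2 (snd \<circ> snd) (\<Delta>, a, b, c)"
    unfolding J comp_def by (rule differentiable_map_at_discrete_snd[OF F3 snd2])
  have "differentiable_map_at ?P3 ?J (\<lambda>y. (\<Delta>, y)) (a, b, c)"
    unfolding J by (rule differentiable_map_at_discrete_Pair[OF id3])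
  from differentiable_fun_at_compose[OF F3 J1 _ this, of L] neJ L[unfolded abc]
  have L3: "differentiable_fun_at ?P3 (\<lambda>y. L (\<Delta>, y)) (a, b, c)"
    by (simp add: comp_def)
  have "differentiable_map_at ?P2 ?P3 (\<lambda>y. (a, y)) (b, c)"
    by (rule differentiable_map_at_Pair[OF differentiable_map_at_const id2])
  from differentiable_fun_at_compose[OF F2 F3 _ this L3] ne3
  have L2: "differentiable_fun_at ?P2 (\<lambda>y. L (\<Delta>, a, y)) (b, c)"
    by (simp add: comp_def)
  let ?w3 = "tangent_map ?J ?P3 snd (\<Delta>, a, b, c) w"
  let ?w2 = "tangent_map ?J ?P2 (snd \<circ> snd) (\<Delta>, a, b, c) w"
  have "differential ?J L z w = differential ?P3 (\<lambda>y. L (\<Delta>, y)) (a, b, c) ?w3"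
    unfolding abc J by (rule differential_discrete_prod[OF F3 id3 ne3 D L[unfolded abc J]])
  also have "\<dots> = differential F (\<lambda>x. L (\<Delta>, x, b, c)) a (tangent_map ?P3 F fst (a, b, c) ?w3) +
      differential ?P2 (\<lambda>y. L (\<Delta>, a, y)) (b, c) (tangent_map ?P3 ?P2 snd (a, b, c) ?w3)"
    by (rule differential_prod[OF F1 id F2 id2 ne[OF y(1)] ne2 L3])
  also have "tangent_map ?P3 ?P2 snd (a, b, c) ?w3 = ?w2"
    using tangent_map_compose[OF J1 F3 neJ _ snd3, of ?P2 snd w] ne3 snd2 by simp
  also have "differential ?P2 (\<lambda>y. L (\<Delta>, a, y)) (b, c) ?w2 =
      differential F (\<lambda>x. L (\<Delta>, a, x, c)) b (tangent_map ?P2 F fst (b, c) ?w2) +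
      differential F (\<lambda>x. L (\<Delta>, a, b, x)) c (tangent_map ?P2 F snd (b, c) ?w2)"
    by (rule differential_prod[OF F1 id F1 id ne[OF y(2)] ne[OF y(3)] L2])
  also have "tangent_map ?P3 F fst (a, b, c) ?w3 = tangent_map ?J F (\<lambda>(\<Delta>, y). component 1 y) z w"
    unfolding jet_component_eq abc
    using tangent_map_compose[OF J1 F3 neJ _ snd3, of F fst w] ne3 fst1 by simp
  also have "tangent_map ?P2 F fst (b, c) ?w2 = tangent_map ?J F (\<lambda>(\<Delta>, y). component 2 y) z w"
    unfolding jet_component_eq abc
    using tangent_map_compose[OF J1 F2 neJ _ snd32, of F fst w] ne2 fst2 by simp
  also have "tangent_map ?P2 F snd (b, c) ?w2 = tangent_map ?J F (\<lambda>(\<Delta>, y). component 3 y) z w"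
    unfolding jet_component_eq abc
    using tangent_map_compose[OF J1 F2 neJ _ snd32, of F snd w] ne2 snd1 by simp
  finally show ?thesis
    by (simp add: Theta_def partial_lagrangian_def abc replace_component_def component_def)
qed

section \<open>Infinitesimal generators and invariance\<close>

lemma action_one:
  assumes "lie_group_action G GM F \<rho>" and "y \<in> points F"
  shows "\<rho> \<one>\<^bsub>G\<^esub> y = y"
proof -
  have "group_action G (points F) \<rho>"
    using assms(1) unfolding lie_group_action_def by blast
  from group_action.id_eq_one[OF this] assms(2) show ?thesis
    by (metis restrict_apply')
qed

lemma lie_group_charts:
  assumes "lie_group G GM"
  shows "smooth_manifold GM" and "charts_at GM \<one>\<^bsub>G\<^esub> \<noteq> {}" and "points GM = carrier G"
proof -
  show M: "smooth_manifold GM" and eq: "points GM = carrier G"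
    using assms unfolding lie_group_def by auto
  have "\<one>\<^bsub>G\<^esub> \<in> points GM"
    using assms eq unfolding lie_group_def by (simp add: group.is_monoid)
  with M show "charts_at GM \<one>\<^bsub>G\<^esub> \<noteq> {}"
    by (rule charts_at_nonempty)
qed

lemma differentiable_orbit_map:
  assumes F: "smooth_manifold F" and G: "lie_group G GM" and A: "lie_group_action G GM F \<rho>"
    and y: "y \<in> points F"
  shows "differentiable_map_at GM F (\<lambda>g. \<rho> g y) g"
proof -
  have "smooth_map (prod_manifold GM F) F (\<lambda>(g, p). \<rho> g p)"
    using A unfolding lie_group_action_def by blast
  from differentiable_map_at_slice[OF lie_group_charts(1)[OF G] open_charts_smooth_manifold[OF F] F this y
      charts_at_nonempty[OF F y]]
  show ?thesis
    by simp
qed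

lemma generator_in_tangent_space:
  assumes F: "smooth_manifold F" and G: "lie_group G GM" and A: "lie_group_action G GM F \<rho>"
    and y: "y \<in> points F"
  shows "infinitesimal_generator G GM F \<rho> \<xi> y \<in> tangent_space F y"
  using tangent_map_in_tangent_space[OF open_charts_smooth_manifold[OF lie_group_charts(1)[OF G]] F
      lie_group_charts(2)[OF G] differentiable_orbit_map[OF assms], of \<xi>]
  unfolding infinitesimal_generator_def action_one[OF A y] .

lemma jet_action_one:
  assumes "lie_group_action G GM F \<rho>" and "z \<in> points (jet_bundle F)"
  shows "jet_action \<rho> \<one>\<^bsub>G\<^esub> z = z"
  using assms(2) action_one[OF assms(1)]
  by (cases z) (auto simp: jet_action_def points_jet_bundle)

lemma differentiable_jet_orbit_map:
  assumes F: "smooth_manifold F" and G: "lie_group G GM" and A: "lie_group_action G GM F \<rho>"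
    and z: "z \<in> points (jet_bundle F)"
  shows "differentiable_map_at GM (jet_bundle F) (\<lambda>g. jet_action \<rho> g z) g"
proof -
  obtain \<Delta> a b c where abc: "z = (\<Delta>, a, b, c)"
    by (cases z)
  have y: "a \<in> points F" "b \<in> points F" "c \<in> points F"
    using z unfolding abc points_jet_bundle by auto
  show ?thesis
    unfolding abc jet_action_def jet_bundle_def prod.case
    by (intro differentiable_map_at_discrete_Pair differentiable_map_at_Pair
        differentiable_orbit_map[OF F G A] y)
qed

text \<open>
  The action on jets is diagonal, so following an orbit of jets by the projection to the \<open>l\<close>-th
  vertex gives the orbit of the \<open>l\<close>-th field value; apply the chain rule at the identity.
\<close>

lemma jet_generator_component:
  assumes F: "smooth_manifold F" and G: "lie_group G GM" and A: "lie_group_action G GM F \<rho>"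
    and z: "(\<Delta>, y) \<in> points (jet_bundle F)" and l: "l \<in> {1, 2, 3}"
  shows "tangent_map (jet_bundle F) F (\<lambda>(\<Delta>, y). component l y) (\<Delta>, y)
      (infinitesimal_generator G GM (jet_bundle F) (jet_action \<rho>) \<xi> (\<Delta>, y)) =
    infinitesimal_generator G GM F \<rho> \<xi> (component l y)"
proof -
  let ?f = "\<lambda>g. jet_action \<rho> g (\<Delta>, y)"
  have "(\<lambda>(\<Delta>, y). component l y) \<circ> ?f = (\<lambda>g. \<rho> g (component l y))"
    by (auto simp: jet_action_def component_def split: prod.split)
  then show ?thesis
    using tangent_map_compose[OF open_charts_smooth_manifold[OF lie_group_charts(1)[OF G]]
        open_charts_jet[OF F] lie_group_charts(2)[OF G] _ differentiable_jet_orbit_map[OF F G A z],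
        of F "\<lambda>(\<Delta>, y). component l y" \<xi>]
      charts_at_jet_nonempty[OF F z] differentiable_jet_component[OF F l, of "(\<Delta>, y)"]
    by (simp add: jet_action_one[OF A z] infinitesimal_generator_def)
qed

text \<open>
  By \<open>differential_eq_sum_Theta\<close> the sum is \<open>dL\<close> evaluated on the generator, hence by the chain
  rule the derivative at the identity of \<open>g \<mapsto> L (g \<cdot> z)\<close>, which is constant on the group.
\<close>

lemma sum_Theta_generator_eq_0:
  assumes F: "smooth_manifold F" and G: "lie_group G GM" and A: "lie_group_action G GM F \<rho>"
    and L: "smooth_fun (jet_bundle F) L" and inv: "invariant_lagrangian G F \<rho> L"
    and z: "z \<in> points (jet_bundle F)"
  shows "(\<Sum>l\<in>{1, 2, 3}. Theta F L l z
      (infinitesimal_generator G GM (jet_bundle F) (jet_action \<rho>) \<xi> z)) = 0"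
proof -
  let ?J = "jet_bundle F" and ?f = "\<lambda>g. jet_action \<rho> g z"
  note GM = lie_group_charts[OF G]
  note GM' = open_charts_smooth_manifold[OF GM(1)]
  define k where "k = (SOME c. c \<in> charts_at GM \<one>\<^bsub>G\<^esub>)"
  have k: "k \<in> charts_at GM \<one>\<^bsub>G\<^esub>"
    unfolding k_def using GM(2) by (rule some_chart)
  then have "fst k \<subseteq> carrier G"
    using smooth_manifold_chart(1)[OF GM(1)] GM(3) openin_subset unfolding charts_at_def by blast
  then have const: "L (?f (chart_inv k u)) = L z" if "u \<in> snd k ` fst k" for u
    using inv z inv_into_into[OF that] unfolding invariant_lagrangian_def by blast
  have ev: "\<forall>\<^sub>F u in nhds (snd k \<one>\<^bsub>G\<^esub>). (L \<circ> ?f \<circ> chart_inv k) u = L z"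
    using open_chartsD(5)[OF GM' k] by eventually_elim (simp add: const)
  have "(\<Sum>l\<in>{1, 2, 3}. Theta F L l z (infinitesimal_generator G GM ?J (jet_action \<rho>) \<xi> z)) =
      differential ?J L z (tangent_map GM ?J ?f \<one>\<^bsub>G\<^esub> \<xi>)"
    unfolding infinitesimal_generator_def
    by (rule differential_eq_sum_Theta[OF F z smooth_fun_differentiable_fun_at[OF L], symmetric])
  also have "\<dots> = differential GM (L \<circ> ?f) \<one>\<^bsub>G\<^esub> \<xi>"
    using differential_compose[OF GM' open_charts_jet[OF F] GM(2) _ differentiable_jet_orbit_map[OF F G A z]
        smooth_fun_differentiable_fun_at[OF L], of \<xi>] charts_at_jet_nonempty[OF F z]
    by (simp add: jet_action_one[OF A z])
  also have "\<dots> = 0"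
    unfolding differential_def Let_def k_def[symmetric] frechet_derivative_cong[OF ev] by simp
  finally show ?thesis .
qed

section \<open>Summation by parts on the lattice\<close>

text \<open>
  A summation by parts with two ways of adding up \<open>a l \<Delta>\<close> over all vertices of all triangles in
  \<open>U\<close>.  Grouped by triangles, the total is 0.  Grouped by vertices, each interior vertex
  contributes 0, since all triangles touching it lie in \<open>U\<close> and so the whole sum in the second
  hypothesis is collected.  Regularity says that the remaining vertices are exactly the boundary
  ones, and triangles without boundary vertices add nothing to what remains.
\<close>

lemma boundary_sum_eq_0:
  fixes a :: "nat \<Rightarrow> triangle \<Rightarrow> 'a::ab_group_add"
  assumes fin: "finite U" and reg: "regular U"
    and tri: "\<And>\<Delta>. \<Delta> \<in> triangles \<Longrightarrow> vertices \<Delta> \<subseteq> U \<Longrightarrow> (\<Sum>l\<in>{1, 2, 3}. a l \<Delta>) = 0"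
    and int: "\<And>x. x \<in> lattice_interior U \<Longrightarrow>
      (\<Sum>(\<Delta>, l)\<in>{(\<Delta>, l). \<Delta> \<in> triangles \<and> l \<in> {1, 2, 3} \<and> vertex l \<Delta> = x}. a l \<Delta>) = 0"
  shows "(\<Sum>\<Delta>\<in>{\<Delta> \<in> triangles. vertices \<Delta> \<subseteq> U \<and> vertices \<Delta> \<inter> lattice_boundary U \<noteq> {}}.
            \<Sum>l\<in>{l \<in> {1, 2, 3}. vertex l \<Delta> \<in> lattice_boundary U}. a l \<Delta>) = 0"
proof -
  let ?I = "lattice_interior U" and ?B = "lattice_boundary U"
  let ?T = "{\<Delta> \<in> triangles. vertices \<Delta> \<subseteq> U}"
  let ?K = "{1, 2, 3 :: nat}"
  have vert: "vertex l \<Delta> \<in> vertices \<Delta>" for l \<Delta>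
    unfolding vertices_def component_def by (auto split: prod.split)
  have finT: "finite ?T"
  proof (rule finite_subset)
    show "?T \<subseteq> U \<times> U \<times> U"
      unfolding vertices_def component_def by auto
  qed (use fin in simp)
  have finI: "finite ?I"
    using fin by (rule finite_subset[rotated]) (auto simp: lattice_interior_def)
  have UIB: "U = ?I \<union> ?B" and disj: "?I \<inter> ?B = {}"
    using reg unfolding regular_def lattice_boundary_def by auto
  have split: "(\<Sum>l\<in>?K. a l \<Delta>) =
      (\<Sum>l\<in>{l \<in> ?K. vertex l \<Delta> \<in> ?I}. a l \<Delta>) + (\<Sum>l\<in>{l \<in> ?K. vertex l \<Delta> \<in> ?B}. a l \<Delta>)"
    if "\<Delta> \<in> ?T" for \<Delta>
  proof -
    have "?K = {l \<in> ?K. vertex l \<Delta> \<in> ?I} \<union> {l \<in> ?K. vertex l \<Delta> \<in> ?B}"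
      using that vert UIB by blast
    then have "(\<Sum>l\<in>?K. a l \<Delta>) =
        (\<Sum>l\<in>{l \<in> ?K. vertex l \<Delta> \<in> ?I} \<union> {l \<in> ?K. vertex l \<Delta> \<in> ?B}. a l \<Delta>)"
      by (rule arg_cong)
    also have "\<dots> = (\<Sum>l\<in>{l \<in> ?K. vertex l \<Delta> \<in> ?I}. a l \<Delta>) + (\<Sum>l\<in>{l \<in> ?K. vertex l \<Delta> \<in> ?B}. a l \<Delta>)"
      using disj by (intro sum.union_disjoint) auto
    finally show ?thesis .
  qed
  have "(\<Sum>\<Delta>\<in>?T. \<Sum>l\<in>{l \<in> ?K. vertex l \<Delta> \<in> ?I}. a l \<Delta>) =
      (\<Sum>(\<Delta>, l)\<in>{(\<Delta>, l). \<Delta> \<in> triangles \<and> l \<in> ?K \<and> vertex l \<Delta> \<in> ?I}. a l \<Delta>)"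
    (is "_ = sum _ ?S")
  proof -
    have "?S = Sigma ?T (\<lambda>\<Delta>. {l \<in> ?K. vertex l \<Delta> \<in> ?I})"
      using vert by (fastforce simp: lattice_interior_def)
    then show ?thesis
      using finT by (simp add: sum.Sigma)
  qed
  also have "\<dots> = (\<Sum>x\<in>?I. \<Sum>(\<Delta>, l)\<in>{s \<in> ?S. (\<lambda>(\<Delta>, l). vertex l \<Delta>) s = x}. a l \<Delta>)"
  proof (rule sum.group[symmetric])
    have "?S \<subseteq> ?T \<times> ?K"
      using vert by (fastforce simp: lattice_interior_def)
    then show "finite ?S"
      by (rule finite_subset) (use finT in simp)
  qed (use finI in auto)
  also have "\<dots> = 0"
  proof (rule sum.neutral, rule ballI)
    fix x
    assume x: "x \<in> ?I"
    then have "{s \<in> ?S. (\<lambda>(\<Delta>, l). vertex l \<Delta>) s = x} =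
        {(\<Delta>, l). \<Delta> \<in> triangles \<and> l \<in> ?K \<and> vertex l \<Delta> = x}"
      by auto
    then show "(\<Sum>(\<Delta>, l)\<in>{s \<in> ?S. (\<lambda>(\<Delta>, l). vertex l \<Delta>) s = x}. a l \<Delta>) = 0"
      using int[OF x] by simp
  qed
  finally have interior: "(\<Sum>\<Delta>\<in>?T. \<Sum>l\<in>{l \<in> ?K. vertex l \<Delta> \<in> ?I}. a l \<Delta>) = 0" .
  have "0 = (\<Sum>\<Delta>\<in>?T. \<Sum>l\<in>?K. a l \<Delta>)"
    using tri by (intro sum.neutral[symmetric]) blast
  also have "\<dots> = (\<Sum>\<Delta>\<in>?T. \<Sum>l\<in>{l \<in> ?K. vertex l \<Delta> \<in> ?B}. a l \<Delta>)"
    using interior by (simp only: sum.cong[OF refl split] sum.distrib add_0_left)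
  also have "\<dots> = (\<Sum>\<Delta>\<in>{\<Delta> \<in> triangles. vertices \<Delta> \<subseteq> U \<and> vertices \<Delta> \<inter> ?B \<noteq> {}}.
      \<Sum>l\<in>{l \<in> ?K. vertex l \<Delta> \<in> ?B}. a l \<Delta>)"
    using vert by (intro sum.mono_neutral_right finT) (fastforce intro!: sum.neutral)+
  finally show ?thesis
    by simp
qed

section \<open>The conservation law\<close>

lemma sum_fun_apply: "(\<Sum>i\<in>A. f i) x = (\<Sum>i\<in>A. f i x)"
  by (induction A rule: infinite_finite_induct) simp_all

theorem mainTheorem6:
  fixes F :: "('f, 'v::real_normed_vector) manifold"
    and G :: "'g monoid"
    and GM :: "('g, 'h::real_normed_vector) manifold"
    and \<rho> :: "'g \<Rightarrow> 'f \<Rightarrow> 'f"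
    and L :: "'f jet \<Rightarrow> real"
    and U :: "point set"
    and \<phi> :: "point \<Rightarrow> 'f"
  assumes "smooth_manifold F"
    and "lie_group G GM"
    and "lie_group_action G GM F \<rho>"
    and "smooth_fun (jet_bundle F) L"
    and "invariant_lagrangian G F \<rho> L"
    and "finite U"
    and "regular U"
    and "\<phi> \<in> sections U F"
    and "discrete_euler_lagrange F L U \<phi>"
  shows "(\<Sum>\<Delta>\<in>{\<Delta> \<in> triangles. vertices \<Delta> \<subseteq> U \<and> vertices \<Delta> \<inter> lattice_boundary U \<noteq> {}}.
            \<Sum>l\<in>{l \<in> {1, 2, 3}. vertex l \<Delta> \<in> lattice_boundary U}.
              momentum_map G GM F \<rho> L l (jet_prolongation \<phi> \<Delta>)) = 0"
proof
  fix \<xi>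
  note F = assms(1) and G = assms(2) and A = assms(3)
  define a where "a = (\<lambda>l \<Delta>. momentum_map G GM F \<rho> L l (jet_prolongation \<phi> \<Delta>) \<xi>)"
  have phi: "\<phi> x \<in> points F" if "x \<in> U" for x
    using assms(8) that unfolding sections_def by blast
  have jet: "jet_prolongation \<phi> \<Delta> \<in> points (jet_bundle F)"
    if "\<Delta> \<in> triangles" "vertices \<Delta> \<subseteq> U" for \<Delta>
    using that phi unfolding jet_prolongation_def points_jet_bundle vertices_def by auto
  have "(\<Sum>\<Delta>\<in>{\<Delta> \<in> triangles. vertices \<Delta> \<subseteq> U \<and> vertices \<Delta> \<inter> lattice_boundary U \<noteq> {}}.
      \<Sum>l\<in>{l \<in> {1, 2, 3}. vertex l \<Delta> \<in> lattice_boundary U}. a l \<Delta>) = 0"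
  proof (rule boundary_sum_eq_0[OF assms(6,7)])
    fix \<Delta>
    assume "\<Delta> \<in> triangles" "vertices \<Delta> \<subseteq> U"
    then show "(\<Sum>l\<in>{1, 2, 3}. a l \<Delta>) = 0"
      using sum_Theta_generator_eq_0[OF F G A assms(4,5) jet, of \<Delta> \<xi>]
      unfolding a_def momentum_map_def interior_product_def by (cases "\<xi> \<in> lie_algebra G GM") simp_all
  next
    fix x
    assume x: "x \<in> lattice_interior U"
    let ?S = "{(\<Delta>, l). \<Delta> \<in> triangles \<and> l \<in> {1, 2, 3} \<and> vertex l \<Delta> = x}"
    show "(\<Sum>(\<Delta>, l)\<in>?S. a l \<Delta>) = 0"
    proof (cases "\<xi> \<in> lie_algebra G GM")
      case True
      have xU: "x \<in> U"
        using x unfolding lattice_interior_def by blast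
      let ?v = "infinitesimal_generator G GM F \<rho> \<xi> (\<phi> x)"
      have "a l \<Delta> = partial_lagrangian F L l (jet_prolongation \<phi> \<Delta>) ?v"
        if "\<Delta> \<in> triangles" and l: "l \<in> {1, 2, 3}" and vx: "vertex l \<Delta> = x" for \<Delta> l
      proof -
        have "x \<in> vertices \<Delta>"
          using l vx unfolding vertices_def by auto
        then have "vertices \<Delta> \<subseteq> U"
          using x that(1) unfolding lattice_interior_def by blast
        then have z: "jet_prolongation \<phi> \<Delta> \<in> points (jet_bundle F)"
          using jet that(1) by blast
        have "component l (\<phi> (vertex 1 \<Delta>), \<phi> (vertex 2 \<Delta>), \<phi> (vertex 3 \<Delta>)) = \<phi> x"
          using l vx by (auto simp: component_def)
        then show ?thesis
          using jet_generator_component[OF F G A z[unfolded jet_prolongation_def] l, of \<xi>] True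
          unfolding a_def momentum_map_def interior_product_def Theta_def jet_prolongation_def
          by simp
      qed
      then have "(\<Sum>(\<Delta>, l)\<in>?S. a l \<Delta>) =
          (\<Sum>(\<Delta>, l)\<in>?S. partial_lagrangian F L l (jet_prolongation \<phi> \<Delta>) ?v)"
        by (intro sum.cong) auto
      also have "\<dots> = 0"
        using assms(9) x generator_in_tangent_space[OF F G A phi[OF xU], of \<xi>]
        unfolding discrete_euler_lagrange_def by blast
      finally show ?thesis .
    qed (simp add: a_def momentum_map_def)
  qed
  then show "(\<Sum>\<Delta>\<in>{\<Delta> \<in> triangles. vertices \<Delta> \<subseteq> U \<and> vertices \<Delta> \<inter> lattice_boundary U \<noteq> {}}.
      \<Sum>l\<in>{l \<in> {1, 2, 3}. vertex l \<Delta> \<in> lattice_boundary U}.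
        momentum_map G GM F \<rho> L l (jet_prolongation \<phi> \<Delta>)) \<xi> = 0 \<xi>"
    unfolding a_def by (simp add: sum_fun_apply)
qed

end
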